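(* Let $F_*$ be a real symmetric positive-definite $3\times3$ matrix with $\det F_*=1$, let $T>0$ and $\nu\ge0$. There exists an exact real-analytic periodic unforced solution $(u,p)$ on $\mathbb T^3_{2\pi}=(\mathbb R/2\pi\mathbb Z)^3$ of $$\partial_tu+u\cdot\nabla u+\nabla p=\nu\Delta u,\qquad\nabla\cdot u=0$$ (Navier--Stokes when $\nu>0$, Euler when $\nu=0$) whose Lagrangian flow $X$ satisfies $$X(0,t)=0\quad(0\le t\le T),\qquad \nabla_aX(0,T)=F_*.$$
   Context: The Lagrangian flow is defined by $\partial_tX(a,t)=u(X(a,t),t)$, $X(a,0)=a$, and $\nabla_aX(a,t)$ is the Jacobian matrix of $X(\cdot,t)$ at $a$. *)

theory Defs
  imports "HOL-Analysis.Analysis"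
begin

text \<open>
  Real analyticity in several variables: near every point of \<open>S\<close> the function is the sum of a power
  series in the coordinates. Multi-indices are the extensional functions \<open>Basis \<rightarrow> nat\<close>, and
  \<^const>\<open>has_sum\<close> is unconditional summation. The ball is a ball of the whole space, so on a set
  that is not open this means analyticity up to the boundary, in the sense that \<open>f\<close> is analytic on
  an open neighbourhood of \<open>S\<close>.
\<close>

definition real_analytic_on ::
    "('a::euclidean_space \<Rightarrow> 'b::real_normed_vector) \<Rightarrow> 'a set \<Rightarrow> bool" where
  "real_analytic_on f S \<longleftrightarrow>
     (\<forall>z\<in>S. \<exists>r>0. \<exists>c :: ('a \<Rightarrow> nat) \<Rightarrow> 'b. \<forall>x\<in>ball z r.
        ((\<lambda>\<alpha>. (\<Prod>b\<in>Basis. ((x - z) \<bullet> b) ^ \<alpha> b) *\<^sub>R c \<alpha>) has_sum f x)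
          (PiE Basis (\<lambda>_. UNIV)))"

text \<open>Functions on the torus are functions on the whole space that are \<open>2\<pi>\<close>-periodic in each coordinate.\<close>

definition torus_periodic :: "(real ^ 'n \<Rightarrow> 'b) \<Rightarrow> bool" where
  "torus_periodic f \<longleftrightarrow> (\<forall>x i. f (x + axis i (2 * pi)) = f x)"

definition partial_deriv :: "'n \<Rightarrow> (real ^ 'n::finite \<Rightarrow> 'b::real_normed_vector) \<Rightarrow> real ^ 'n \<Rightarrow> 'b" where
  "partial_deriv j f x = frechet_derivative f (at x) (axis j 1)"

definition gradient :: "(real ^ 'n::finite \<Rightarrow> real) \<Rightarrow> real ^ 'n \<Rightarrow> real ^ 'n" where
  "gradient f x = (\<chi> j. partial_deriv j f x)"

definition divergence :: "(real ^ 'n::finite \<Rightarrow> real ^ 'n) \<Rightarrow> real ^ 'n \<Rightarrow> real" where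
  "divergence v x = (\<Sum>j\<in>UNIV. partial_deriv j v x $ j)"

definition laplacian :: "(real ^ 'n::finite \<Rightarrow> 'b::real_normed_vector) \<Rightarrow> real ^ 'n \<Rightarrow> 'b" where
  "laplacian f x = (\<Sum>j\<in>UNIV. partial_deriv j (partial_deriv j f) x)"

text \<open>The advection term \<open>(v \<cdot> \<nabla>) w\<close>.\<close>

definition advection ::
    "(real ^ 'n::finite \<Rightarrow> real ^ 'n) \<Rightarrow> (real ^ 'n \<Rightarrow> 'b::real_normed_vector) \<Rightarrow> real ^ 'n \<Rightarrow> 'b" where
  "advection v w x = (\<Sum>j\<in>UNIV. (v x $ j) *\<^sub>R partial_deriv j w x)"

text \<open>
  Real-analytic periodic solutions, for all times \<open>t \<ge> 0\<close>, of the unforced incompressible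
  Navier--Stokes (\<open>\<nu> > 0\<close>) or Euler (\<open>\<nu> = 0\<close>) equations. Analyticity is joint in space and time;
  it also guarantees that all derivatives below exist, including the two-sided time derivative at
  \<open>t = 0\<close>.
\<close>

definition analytic_periodic_solution ::
    "real \<Rightarrow> (real ^ 3 \<Rightarrow> real \<Rightarrow> real ^ 3) \<Rightarrow> (real ^ 3 \<Rightarrow> real \<Rightarrow> real) \<Rightarrow> bool" where
  "analytic_periodic_solution \<nu> u p \<longleftrightarrow>
     real_analytic_on (\<lambda>(x, t). u x t) (UNIV \<times> {0..}) \<and>
     real_analytic_on (\<lambda>(x, t). p x t) (UNIV \<times> {0..}) \<and>
     (\<forall>t\<ge>0. torus_periodic (\<lambda>x. u x t) \<and> torus_periodic (\<lambda>x. p x t)) \<and>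
     (\<forall>t\<ge>0. \<forall>x.
        vector_derivative (\<lambda>s. u x s) (at t) + advection (\<lambda>y. u y t) (\<lambda>y. u y t) x
            + gradient (\<lambda>y. p y t) x = \<nu> *\<^sub>R laplacian (\<lambda>y. u y t) x \<and>
        divergence (\<lambda>y. u y t) x = 0)"

definition lagrangian_flow ::
    "(real ^ 'n \<Rightarrow> real \<Rightarrow> real ^ 'n) \<Rightarrow> (real ^ 'n \<Rightarrow> real \<Rightarrow> real ^ 'n) \<Rightarrow> bool" where
  "lagrangian_flow u X \<longleftrightarrow>
     (\<forall>a. X a 0 = a \<and>
        (\<forall>t\<ge>0. ((\<lambda>s. X a s) has_vector_derivative u (X a t) t) (at t within {0..})))"

end

theory Submission
  imports Defs
begin

text \<open>
  A Beltrami field \<open>v\<close> with \<open>curl v = l v\<close> satisfies \<open>(v \<cdot> \<nabla>) v = \<nabla> (\<bar>v\<bar>\<^sup>2 / 2)\<close> and \<open>\<Delta> v = - l\<^sup>2 v\<close>, so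
  \<open>u = exp (- \<nu> l\<^sup>2 t) v\<close> solves the equations with pressure \<open>- \<bar>u\<bar>\<^sup>2 / 2\<close>, and its Lagrangian flow is
  the flow of \<open>v\<close> at the time \<open>\<theta> t\<close>, the integral of \<open>exp (- \<nu> l\<^sup>2 s)\<close> over \<open>{0..t}\<close>. If \<open>v 0 = 0\<close>
  and \<open>\<nabla>v 0 = S\<close>, the gradient of the flow at the origin is \<open>exp (\<theta> T S)\<close>, hence one wants
  \<open>S = log F / \<theta> T\<close>, which is symmetric and trace-free. Such a \<open>v\<close> is found among the sums of
  \<open>sin (k \<bullet> x) a\<^sub>k + cos (k \<bullet> x) (k \<times> a\<^sub>k) / l\<close> with \<open>k \<bullet> a\<^sub>k = 0\<close> and \<open>\<bar>k\<bar>\<^sup>2 = l\<^sup>2 = 3\<close>: the gradient at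
  the origin is the sum of the matrices \<open>a\<^sub>k k\<^sup>T\<close>, and when this is symmetric the value at the origin
  vanishes.
\<close>

section \<open>Real-analytic functions\<close>

lemma real_analytic_onI:
  assumes "\<And>z. z \<in> S \<Longrightarrow> \<exists>c. \<forall>x. ((\<lambda>\<alpha>. (\<Prod>b\<in>Basis. ((x - z) \<bullet> b) ^ \<alpha> b) *\<^sub>R c \<alpha>) has_sum f x)
    (PiE Basis (\<lambda>_. UNIV))"
  shows "real_analytic_on f S"
  unfolding real_analytic_on_def
  using assms zero_less_one by blast

text \<open>\<open>l h\<close> is the sum of the \<open>(h \<bullet> b) *\<^sub>R l b\<close>, so
  \<open>exp (l h)\<close> is a finite product of one-variable exponential series. These converge
  absolutely and may be multiplied out into one unconditional sum over multi-indices.\<close>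

lemma has_sum_exp_linear:
  fixes l :: "'a::euclidean_space \<Rightarrow> complex"
  assumes "linear l"
  shows "((\<lambda>\<alpha>. (\<Prod>b\<in>Basis. (h \<bullet> b) ^ \<alpha> b) *\<^sub>R (\<Prod>b\<in>Basis. l b ^ \<alpha> b /\<^sub>R fact (\<alpha> b)))
    has_sum exp (l h)) (PiE Basis (\<lambda>_. UNIV))"
proof -
  define f where "f b n = ((h \<bullet> b) *\<^sub>R l b) ^ n /\<^sub>R fact n" for b and n :: nat
  have fin: "finite (Basis :: 'a set)" by simp
  have abs: "Infinite_Set_Sum.abs_summable_on (f b) UNIV" for b
    unfolding f_def abs_summable_on_nat_iff' by (rule summable_norm_exp)
  have one: "infsetsum (f b) UNIV = exp ((h \<bullet> b) *\<^sub>R l b)" for b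
    using infsetsum_nat'[OF abs] by (simp add: f_def exp_def)
  have pabs: "Infinite_Set_Sum.abs_summable_on (\<lambda>\<alpha>. \<Prod>b\<in>Basis. f b (\<alpha> b)) (PiE Basis (\<lambda>_. UNIV))"
    by (rule abs_summable_on_prod_PiE[OF fin _ abs]) auto
  have "infsetsum (\<lambda>\<alpha>. \<Prod>b\<in>Basis. f b (\<alpha> b)) (PiE Basis (\<lambda>_. UNIV)) = (\<Prod>b\<in>Basis. infsetsum (f b) UNIV)"
    by (rule infsetsum_prod_PiE[OF fin _ abs]) auto
  also have "\<dots> = exp (\<Sum>b\<in>Basis. (h \<bullet> b) *\<^sub>R l b)"
    by (simp add: one exp_sum)
  also have "(\<Sum>b\<in>Basis. (h \<bullet> b) *\<^sub>R l b) = l (\<Sum>b\<in>Basis. (h \<bullet> b) *\<^sub>R b)"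
    using assms by (simp add: linear_sum linear_cmul)
  \<comment> \<open>Absolute summability carries the product formula for \<open>infsetsum\<close>
    over to \<open>infsum\<close>, and from there to \<open>has_sum\<close>.\<close>
  finally have "infsum (\<lambda>\<alpha>. \<Prod>b\<in>Basis. f b (\<alpha> b)) (PiE Basis (\<lambda>_. UNIV)) = exp (l h)"
    by (simp only: infsetsum_infsum[OF pabs] euclidean_representation)
  moreover have "(\<lambda>\<alpha>. \<Prod>b\<in>Basis. f b (\<alpha> b)) summable_on (PiE Basis (\<lambda>_. UNIV))"
    by (rule abs_summable_summable[OF pabs[folded abs_summable_equivalent]])
  ultimately have "((\<lambda>\<alpha>. \<Prod>b\<in>Basis. f b (\<alpha> b)) has_sum exp (l h)) (PiE Basis (\<lambda>_. UNIV))"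
    by (metis has_sum_infsum)
  moreover have "(\<Prod>b\<in>Basis. f b (\<alpha> b)) =
      (\<Prod>b\<in>Basis. (h \<bullet> b) ^ \<alpha> b) *\<^sub>R (\<Prod>b\<in>Basis. l b ^ \<alpha> b /\<^sub>R fact (\<alpha> b))" for \<alpha>
  proof -
    have "f b n = of_real ((h \<bullet> b) ^ n) * (l b ^ n /\<^sub>R fact n)" for b n
      by (simp add: f_def scaleR_conv_of_real power_mult_distrib)
    then show ?thesis
      by (simp add: prod.distrib scaleR_conv_of_real)
  qed
  ultimately show ?thesis by simp
qed

text \<open>About \<open>z\<close>, write \<open>exp (l x) = exp (l z) * exp (l (x - z))\<close>:
  the factor \<open>C * exp (l z)\<close>, the real part and the vector \<open>v\<close> make up one
  bounded linear map, which passes through the series. As \<open>l\<close> is real-linear with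
  complex values, its real part can encode growth in time and its imaginary part oscillation in
  space.\<close>

lemma real_analytic_on_Re_exp_linear:
  fixes l :: "'a::euclidean_space \<Rightarrow> complex"
  assumes "linear l"
  shows "real_analytic_on (\<lambda>x. Re (C * exp (l x)) *\<^sub>R v) S"
proof (intro real_analytic_onI exI allI)
  fix z x :: 'a
  let ?P = "\<lambda>\<alpha>. \<Prod>b\<in>Basis. l b ^ \<alpha> b /\<^sub>R fact (\<alpha> b)"
  let ?M = "\<lambda>\<alpha>. \<Prod>b\<in>Basis. ((x - z) \<bullet> b) ^ \<alpha> b"
  have bl: "bounded_linear (\<lambda>w. Re (C * exp (l z) * w) *\<^sub>R v)"
    by (intro bounded_linear_scaleR_const bounded_linear_compose[OF bounded_linear_Re]
        bounded_linear_mult_right)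
  have "((\<lambda>\<alpha>. Re (C * exp (l z) * (?M \<alpha> *\<^sub>R ?P \<alpha>)) *\<^sub>R v) has_sum Re (C * exp (l z) * exp (l (x - z))) *\<^sub>R v)
     (PiE Basis (\<lambda>_. UNIV))"
    by (rule has_sum_bounded_linear[OF bl has_sum_exp_linear[OF assms]])
  moreover have "C * exp (l z) * exp (l (x - z)) = C * exp (l x)"
    using assms by (simp add: linear_diff exp_diff)
  moreover have "Re (C * exp (l z) * (?M \<alpha> *\<^sub>R ?P \<alpha>)) *\<^sub>R v = ?M \<alpha> *\<^sub>R (Re (C * exp (l z) * ?P \<alpha>) *\<^sub>R v)" for \<alpha>
    by (simp only: mult_scaleR_right scaleR_complex.sel scaleR_scaleR)
  ultimately show "((\<lambda>\<alpha>. ?M \<alpha> *\<^sub>R (Re (C * exp (l z) * ?P \<alpha>) *\<^sub>R v)) has_sum Re (C * exp (l x)) *\<^sub>R v)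
     (PiE Basis (\<lambda>_. UNIV))"
    by simp
qed

lemma real_analytic_on_add:
  assumes "real_analytic_on f S" "real_analytic_on g S"
  shows "real_analytic_on (\<lambda>x. f x + g x) S"
  unfolding real_analytic_on_def
proof
  fix z assume "z \<in> S"
  let ?m = "\<lambda>x \<alpha>. \<Prod>b\<in>Basis. ((x - z) \<bullet> b) ^ \<alpha> b"
  obtain r c where r: "r > 0" and c: "\<forall>x\<in>ball z r. ((\<lambda>\<alpha>. ?m x \<alpha> *\<^sub>R c \<alpha>) has_sum f x) (PiE Basis (\<lambda>_. UNIV))"
    using assms(1) \<open>z \<in> S\<close> unfolding real_analytic_on_def by meson
  obtain s d where s: "s > 0" and d: "\<forall>x\<in>ball z s. ((\<lambda>\<alpha>. ?m x \<alpha> *\<^sub>R d \<alpha>) has_sum g x) (PiE Basis (\<lambda>_. UNIV))"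
    using assms(2) \<open>z \<in> S\<close> unfolding real_analytic_on_def by meson
  have "((\<lambda>\<alpha>. ?m x \<alpha> *\<^sub>R (c \<alpha> + d \<alpha>)) has_sum f x + g x) (PiE Basis (\<lambda>_. UNIV))"
    if "x \<in> ball z (min r s)" for x
    using has_sum_add[OF c[rule_format] d[rule_format], of x] that by (simp add: scaleR_add_right)
  then show "\<exists>r>0. \<exists>c. \<forall>x\<in>ball z r. ((\<lambda>\<alpha>. ?m x \<alpha> *\<^sub>R c \<alpha>) has_sum f x + g x) (PiE Basis (\<lambda>_. UNIV))"
    using r s by (intro exI[of _ "min r s"] conjI exI[of _ "\<lambda>\<alpha>. c \<alpha> + d \<alpha>"]) auto
qed

lemma real_analytic_on_zero: "real_analytic_on (\<lambda>x. 0) S"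
  by (intro real_analytic_onI exI[of _ "\<lambda>_. 0"]) simp

lemma real_analytic_on_sum:
  "(\<And>i. i \<in> I \<Longrightarrow> real_analytic_on (f i) S) \<Longrightarrow> real_analytic_on (\<lambda>x. \<Sum>i\<in>I. f i x) S"
  by (induction I rule: infinite_finite_induct) (simp_all add: real_analytic_on_zero real_analytic_on_add)

section \<open>Trigonometric waves\<close>

text \<open>Both are real parts of \<open>C * exp (\<beta> * t + \<i> * (k \<bullet> x))\<close>,
  with \<open>C = 1\<close> for the cosine and \<open>C = - \<i>\<close> for the sine.\<close>

lemma real_analytic_on_exp_trig:
  fixes k :: "'a::euclidean_space"
  shows "real_analytic_on (\<lambda>(x, t). (exp (\<beta> * t) * cos (k \<bullet> x)) *\<^sub>R v) S"
    and "real_analytic_on (\<lambda>(x, t). (exp (\<beta> * t) * sin (k \<bullet> x)) *\<^sub>R v) S"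
proof -
  define l where "l z = Complex (\<beta> * snd z) (k \<bullet> fst z)" for z :: "'a \<times> real"
  have "linear l"
    by (rule linearI) (auto simp: l_def complex_eq_iff inner_add_right distrib_left)
  note * = real_analytic_on_Re_exp_linear[OF this, where v = v and S = S]
  show "real_analytic_on (\<lambda>(x, t). (exp (\<beta> * t) * cos (k \<bullet> x)) *\<^sub>R v) S"
    using *[of 1] by (simp add: l_def case_prod_unfold Re_exp)
  show "real_analytic_on (\<lambda>(x, t). (exp (\<beta> * t) * sin (k \<bullet> x)) *\<^sub>R v) S"
    using *[of "- \<i>"] by (simp add: l_def case_prod_unfold Im_exp)
qed

text \<open>Product-to-sum formulas turn each product into two waves with wave vectors
  \<open>k + l\<close> and \<open>k - l\<close>. The quadratic pressure involves only such products,
  so this stands in for a general theorem on products of analytic functions.\<close>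

lemma real_analytic_on_exp_trig_mult_trig:
  fixes k l :: "'a::euclidean_space"
  shows "real_analytic_on (\<lambda>(x, t). (exp (\<beta> * t) * (sin (k \<bullet> x) * sin (l \<bullet> x))) *\<^sub>R v) S"
    and "real_analytic_on (\<lambda>(x, t). (exp (\<beta> * t) * (sin (k \<bullet> x) * cos (l \<bullet> x))) *\<^sub>R v) S"
    and "real_analytic_on (\<lambda>(x, t). (exp (\<beta> * t) * (cos (k \<bullet> x) * cos (l \<bullet> x))) *\<^sub>R v) S"
proof -
  note t = real_analytic_on_exp_trig[where \<beta> = \<beta> and S = S, unfolded case_prod_unfold]
  have ss: "e * (sin (k \<bullet> x) * sin (l \<bullet> x)) = e * cos ((k - l) \<bullet> x) * (1/2) + e * cos ((k + l) \<bullet> x) * (- (1/2))"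
    and sc: "e * (sin (k \<bullet> x) * cos (l \<bullet> x)) = e * sin ((k + l) \<bullet> x) * (1/2) + e * sin ((k - l) \<bullet> x) * (1/2)"
    and cc: "e * (cos (k \<bullet> x) * cos (l \<bullet> x)) = e * cos ((k - l) \<bullet> x) * (1/2) + e * cos ((k + l) \<bullet> x) * (1/2)"
    for e x
    unfolding inner_diff_left inner_add_left sin_times_sin sin_times_cos cos_times_cos
    by argo+
  show "real_analytic_on (\<lambda>(x, t). (exp (\<beta> * t) * (sin (k \<bullet> x) * sin (l \<bullet> x))) *\<^sub>R v) S"
    unfolding case_prod_unfold ss scaleR_add_left scaleR_scaleR[symmetric, of "_ * cos _"]
    by (intro real_analytic_on_add t)
  show "real_analytic_on (\<lambda>(x, t). (exp (\<beta> * t) * (sin (k \<bullet> x) * cos (l \<bullet> x))) *\<^sub>R v) S"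
    unfolding case_prod_unfold sc scaleR_add_left scaleR_scaleR[symmetric, of "_ * sin _"]
    by (intro real_analytic_on_add t)
  show "real_analytic_on (\<lambda>(x, t). (exp (\<beta> * t) * (cos (k \<bullet> x) * cos (l \<bullet> x))) *\<^sub>R v) S"
    unfolding case_prod_unfold cc scaleR_add_left scaleR_scaleR[symmetric, of "_ * cos _"]
    by (intro real_analytic_on_add t)
qed

section \<open>Finite sums of waves and their derivatives\<close>

text \<open>With independent sine and cosine amplitudes the class is closed under partial
  derivatives, so differential operators become algebra on the amplitudes.\<close>

definition wave :: "'a::real_inner set \<Rightarrow> ('a \<Rightarrow> 'b::real_normed_vector) \<Rightarrow> ('a \<Rightarrow> 'b) \<Rightarrow> 'a \<Rightarrow> 'b" where
  "wave K a b x = (\<Sum>k\<in>K. sin (k \<bullet> x) *\<^sub>R a k + cos (k \<bullet> x) *\<^sub>R b k)"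

definition wave_deriv :: "'a::real_inner set \<Rightarrow> ('a \<Rightarrow> 'b::real_normed_vector) \<Rightarrow> ('a \<Rightarrow> 'b) \<Rightarrow> 'a \<Rightarrow> 'a \<Rightarrow> 'b" where
  "wave_deriv K a b x h = (\<Sum>k\<in>K. (k \<bullet> h) *\<^sub>R (cos (k \<bullet> x) *\<^sub>R a k - sin (k \<bullet> x) *\<^sub>R b k))"

lemma real_analytic_on_wave:
  fixes K :: "'a::euclidean_space set"
  shows "real_analytic_on (\<lambda>(x, t). exp (\<beta> * t) *\<^sub>R wave K a b x) S"
proof -
  have "real_analytic_on (\<lambda>z. \<Sum>k\<in>K. (exp (\<beta> * snd z) * sin (k \<bullet> fst z)) *\<^sub>R a k
      + (exp (\<beta> * snd z) * cos (k \<bullet> fst z)) *\<^sub>R b k) S"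
    by (intro real_analytic_on_sum real_analytic_on_add real_analytic_on_exp_trig[unfolded case_prod_unfold])
  then show ?thesis
    by (simp add: wave_def case_prod_unfold scaleR_sum_right scaleR_add_right)
qed

text \<open>The square expands into a double sum of products of two trigonometric factors. With the
  weight \<open>v = - (1/2)\<close> it becomes the pressure.\<close>

lemma real_analytic_on_wave_inner_wave:
  fixes K :: "'a::euclidean_space set" and a b :: "'a \<Rightarrow> 'b::real_inner"
  shows "real_analytic_on (\<lambda>(x, t). (exp (\<beta> * t) * (wave K a b x \<bullet> wave K a b x)) *\<^sub>R v) S"
proof -
  have "real_analytic_on (\<lambda>z. \<Sum>k\<in>K. \<Sum>l\<in>K.
      ((exp (\<beta> * snd z) * (sin (k \<bullet> fst z) * sin (l \<bullet> fst z))) *\<^sub>R (a k \<bullet> a l) *\<^sub>R v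
       + (exp (\<beta> * snd z) * (sin (k \<bullet> fst z) * cos (l \<bullet> fst z))) *\<^sub>R (a k \<bullet> b l) *\<^sub>R v)
       + ((exp (\<beta> * snd z) * (sin (l \<bullet> fst z) * cos (k \<bullet> fst z))) *\<^sub>R (b k \<bullet> a l) *\<^sub>R v
       + (exp (\<beta> * snd z) * (cos (k \<bullet> fst z) * cos (l \<bullet> fst z))) *\<^sub>R (b k \<bullet> b l) *\<^sub>R v)) S"
    by (intro real_analytic_on_sum real_analytic_on_add real_analytic_on_exp_trig_mult_trig[unfolded case_prod_unfold])
  moreover have "(exp (\<beta> * snd z) * (wave K a b (fst z) \<bullet> wave K a b (fst z))) *\<^sub>R v =
     (\<Sum>k\<in>K. \<Sum>l\<in>K.
      ((exp (\<beta> * snd z) * (sin (k \<bullet> fst z) * sin (l \<bullet> fst z))) *\<^sub>R (a k \<bullet> a l) *\<^sub>R v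
       + (exp (\<beta> * snd z) * (sin (k \<bullet> fst z) * cos (l \<bullet> fst z))) *\<^sub>R (a k \<bullet> b l) *\<^sub>R v)
       + ((exp (\<beta> * snd z) * (sin (l \<bullet> fst z) * cos (k \<bullet> fst z))) *\<^sub>R (b k \<bullet> a l) *\<^sub>R v
       + (exp (\<beta> * snd z) * (cos (k \<bullet> fst z) * cos (l \<bullet> fst z))) *\<^sub>R (b k \<bullet> b l) *\<^sub>R v))" for z
    unfolding wave_def inner_sum_left inner_sum_right sum_distrib_left scaleR_sum_left
    by (subst sum.swap, intro sum.cong refl) (simp add: inner_add_left inner_add_right algebra_simps)
  ultimately show ?thesis by (simp add: case_prod_unfold)
qed

lemma wave_scaleR: "wave K (\<lambda>k. c *\<^sub>R a k) (\<lambda>k. c *\<^sub>R b k) x = c *\<^sub>R wave K a b x"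
  by (simp add: wave_def scaleR_sum_right scaleR_add_right mult.commute)

lemma wave_has_derivative: "(wave K a b has_derivative wave_deriv K a b x) (at x)"
  unfolding wave_def[abs_def] wave_deriv_def[abs_def]
  by (auto intro!: derivative_eq_intros sum.cong simp: fun_eq_iff algebra_simps)

lemma frechet_derivative_wave: "frechet_derivative (wave K a b) (at x) = wave_deriv K a b x"
  by (rule frechet_derivative_at[OF wave_has_derivative, symmetric])

lemma partial_deriv_wave:
  "partial_deriv j (wave K a b) = wave K (\<lambda>k. - (k $ j) *\<^sub>R b k) (\<lambda>k. k $ j *\<^sub>R a k)"
  by (auto simp: fun_eq_iff partial_deriv_def frechet_derivative_wave wave_deriv_def wave_def inner_axis
      algebra_simps intro!: sum.cong)

lemma laplacian_wave:
  assumes "\<And>k. k \<in> K \<Longrightarrow> k \<bullet> k = m"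
  shows "laplacian (wave K a b) x = - m *\<^sub>R wave K a b x"
proof -
  have "laplacian (wave K a b) x = (\<Sum>k\<in>K. \<Sum>j\<in>UNIV. - (k $ j * k $ j) *\<^sub>R (sin (k \<bullet> x) *\<^sub>R a k + cos (k \<bullet> x) *\<^sub>R b k))"
    unfolding laplacian_def partial_deriv_wave
    by (subst sum.swap) (auto simp: wave_def algebra_simps intro!: sum.cong)
  also have "\<dots> = (\<Sum>k\<in>K. - (k \<bullet> k) *\<^sub>R (sin (k \<bullet> x) *\<^sub>R a k + cos (k \<bullet> x) *\<^sub>R b k))"
    by (simp add: inner_vec_def sum_negf scaleR_sum_left)
  also have "\<dots> = - m *\<^sub>R wave K a b x"
    using assms by (simp add: wave_def scaleR_sum_right)
  finally show ?thesis .
qed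

lemma divergence_wave:
  assumes "\<And>k. k \<in> K \<Longrightarrow> k \<bullet> a k = 0" "\<And>k. k \<in> K \<Longrightarrow> k \<bullet> b k = 0"
  shows "divergence (wave K a b) x = 0"
proof -
  have "divergence (wave K a b) x = (\<Sum>k\<in>K. \<Sum>j\<in>UNIV. cos (k \<bullet> x) * (k $ j * a k $ j) - sin (k \<bullet> x) * (k $ j * b k $ j))"
    unfolding divergence_def partial_deriv_wave
    by (subst sum.swap) (auto simp: wave_def algebra_simps intro!: sum.cong)
  also have "\<dots> = (\<Sum>k\<in>K. cos (k \<bullet> x) * (k \<bullet> a k) - sin (k \<bullet> x) * (k \<bullet> b k))"
    by (simp add: inner_vec_def sum_subtractf sum_distrib_left)
  finally show ?thesis using assms by simp
qed

lemma torus_periodic_wave: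
  assumes "\<And>k i. k \<in> K \<Longrightarrow> k $ i \<in> \<int>"
  shows "torus_periodic (wave K a b)"
proof -
  have "sin (k \<bullet> (x + axis i (2 * pi))) = sin (k \<bullet> x) \<and> cos (k \<bullet> (x + axis i (2 * pi))) = cos (k \<bullet> x)"
    if k: "k \<in> K" for k x i
  proof -
    obtain n where "k $ i = of_int n" using assms[OF k, of i] by (auto elim: Ints_cases)
    then have "k \<bullet> (x + axis i (2 * pi)) = k \<bullet> x + 2 * pi * of_int n"
      by (simp add: inner_add_right inner_axis)
    then show ?thesis
      by (simp add: sin_add cos_add sin_integer_2pi cos_integer_2pi)
  qed
  then show ?thesis by (simp add: torus_periodic_def wave_def)
qed

text \<open>The derivative is bounded uniformly in \<open>x\<close>, as sines and cosines are. A
  global Lipschitz constant gives trajectories for all times and, where the field vanishes at 0, a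
  bound linear in \<open>norm y\<close>.\<close>

lemma wave_lipschitz:
  fixes K :: "'a::euclidean_space set" and a b :: "'a \<Rightarrow> 'b::real_normed_vector"
  obtains L where "L-lipschitz_on UNIV (wave K a b)"
proof -
  let ?L = "\<Sum>k\<in>K. norm k * (norm (a k) + norm (b k))"
  have "norm (wave_deriv K a b x h) \<le> ?L * norm h" for x h
  proof -
    have "norm (wave_deriv K a b x h) \<le> (\<Sum>k\<in>K. norm ((k \<bullet> h) *\<^sub>R (cos (k \<bullet> x) *\<^sub>R a k - sin (k \<bullet> x) *\<^sub>R b k)))"
      unfolding wave_deriv_def by (rule norm_sum)
    also have "\<dots> \<le> (\<Sum>k\<in>K. norm k * norm h * (norm (a k) + norm (b k)))"
    proof (rule sum_mono)
      fix k
      have "norm (cos (k \<bullet> x) *\<^sub>R a k - sin (k \<bullet> x) *\<^sub>R b k) \<le> \<bar>cos (k \<bullet> x)\<bar> * norm (a k) + \<bar>sin (k \<bullet> x)\<bar> * norm (b k)"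
        using norm_triangle_ineq4[of "cos (k \<bullet> x) *\<^sub>R a k" "sin (k \<bullet> x) *\<^sub>R b k"] by simp
      also have "\<dots> \<le> norm (a k) + norm (b k)"
        by (intro add_mono mult_left_le_one_le) auto
      finally show "norm ((k \<bullet> h) *\<^sub>R (cos (k \<bullet> x) *\<^sub>R a k - sin (k \<bullet> x) *\<^sub>R b k))
          \<le> norm k * norm h * (norm (a k) + norm (b k))"
        using Cauchy_Schwarz_ineq2[of k h] by (auto intro!: mult_mono)
    qed
    also have "\<dots> = ?L * norm h" by (simp add: sum_distrib_left sum_distrib_right mult_ac)
    finally show ?thesis .
  qed
  then have "onorm (wave_deriv K a b x) \<le> ?L" for x
    by (rule onorm_le)
  then have "norm (wave K a b x - wave K a b y) \<le> ?L * norm (x - y)" for x y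
    by (intro differentiable_bound[of UNIV "wave K a b" "wave_deriv K a b"])
       (auto intro: wave_has_derivative)
  then have "?L-lipschitz_on UNIV (wave K a b)"
    by (intro lipschitz_onI) (auto simp: dist_norm intro!: sum_nonneg)
  then show ?thesis by (rule that)
qed

section \<open>Global flows and their linearization at an equilibrium\<close>

text \<open>
  Picard iteration in the norm weighted by \<open>exp (- 2 L t)\<close>: in this norm the integral operator is a
  contraction on the whole half-line, so no gluing of local solutions is needed.
\<close>

lemma norm_integral_exp_weight_le:
  fixes g :: "real \<Rightarrow> 'a::euclidean_space"
  assumes g: "continuous_on {0..t} g" and t: "0 \<le> t" and L: "L > 0"
    and bound: "\<And>s. s \<in> {0..t} \<Longrightarrow> norm (g s) \<le> L * (exp (2 * L * s) * K)" and K: "K \<ge> 0"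
  shows "exp (- 2 * L * t) * norm (integral {0..t} g) \<le> K / 2"
proof -
  \<comment> \<open>The weight grows at twice the rate \<open>L\<close>, and this is the source of
    the factor 1/2 in the antiderivative and hence of the contraction.\<close>
  have "((\<lambda>s. L * (exp (2 * L * s) * K)) has_integral exp (2 * L * t) * K / 2 - exp (2 * L * 0) * K / 2) {0..t}"
    using t L by (intro fundamental_theorem_of_calculus)
      (auto intro!: derivative_eq_intros simp flip: has_real_derivative_iff_has_vector_derivative)
  then have bnd: "(\<lambda>s. L * (exp (2 * L * s) * K)) integrable_on {0..t}"
      "integral {0..t} (\<lambda>s. L * (exp (2 * L * s) * K)) = exp (2 * L * t) * K / 2 - exp (2 * L * 0) * K / 2"
    by (auto simp: has_integral_iff)
  have "norm (integral {0..t} g) \<le> exp (2 * L * t) * K / 2 - exp (2 * L * 0) * K / 2"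
    unfolding bnd(2)[symmetric]
    by (rule integral_norm_bound_integral[OF integrable_continuous_interval[OF g] bnd(1) bound])
  also have "\<dots> \<le> exp (2 * L * t) * K / 2" using K by simp
  finally have "exp (- 2 * L * t) * norm (integral {0..t} g) \<le> exp (- 2 * L * t) * (exp (2 * L * t) * K / 2)"
    by (intro mult_left_mono) auto
  also have "\<dots> = K / 2" by (simp flip: exp_add mult.assoc)
  finally show ?thesis .
qed

lemma lipschitz_ode_global_solution:
  fixes f :: "'a::euclidean_space \<Rightarrow> 'a"
  assumes lip: "L-lipschitz_on UNIV f" and f0: "f 0 = 0"
  obtains x where "x 0 = a" "\<And>t. t \<ge> 0 \<Longrightarrow> (x has_vector_derivative f (x t)) (at t within {0..})"
proof -
  \<comment> \<open>\<open>L\<close> may be 0, whereas the weighted estimate requires a positive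
    rate.\<close>
  define M where "M = L + 1"
  have "L \<ge> 0" using lip by (rule lipschitz_on_nonneg)
  then have M: "M > 0" by (simp add: M_def)
  have fdist: "norm (f y - f z) \<le> M * norm (y - z)" for y z
  proof -
    have "norm (f y - f z) \<le> L * norm (y - z)" using lipschitz_onD[OF lip, of y z] by (simp add: dist_norm)
    also have "\<dots> \<le> M * norm (y - z)" by (intro mult_right_mono) (auto simp: M_def)
    finally show ?thesis .
  qed
  have fnorm: "norm (f y) \<le> M * norm y" for y using fdist[of y 0] by (simp add: f0)
  have fcont: "continuous_on S f" for S
    using lip lipschitz_on_continuous_on continuous_on_subset by blast
  \<comment> \<open>The bounded function \<open>\<psi>\<close> stands for the trajectory divided by
    \<open>exp (2 * M * s)\<close>, so \<open>g \<psi>\<close> is \<open>f\<close> along the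
    trajectory itself.\<close>
  define g where "g \<psi> s = f (exp (2 * M * s) *\<^sub>R apply_bcontfun \<psi> s)" for \<psi> :: "real \<Rightarrow>\<^sub>C 'a" and s
  have gcont: "continuous_on S (g \<psi>)" for \<psi> S
    unfolding g_def by (intro continuous_on_compose2[OF fcont[of UNIV]] continuous_intros) auto
  have gint: "g \<psi> integrable_on {u..v}" for \<psi> u v
    by (rule integrable_continuous_interval[OF gcont])
  \<comment> \<open>This is the weighted Picard operator. Bounded continuous functions live on the
    whole line, so \<open>max 0 t\<close> freezes the value at negative times.\<close>
  define P where "P \<psi> t = exp (- 2 * M * max 0 t) *\<^sub>R (a + integral {0..max 0 t} (g \<psi>))" for \<psi> t
  have Icont: "continuous_on UNIV (\<lambda>t. integral {0..max 0 t} (g \<psi>))" for \<psi>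
  proof -
    have "continuous_on {0..} (\<lambda>t. integral {0..t} (g \<psi>))"
      unfolding continuous_on_eq_continuous_within
    proof
      fix t :: real assume t: "t \<in> {0..}"
      have "((\<lambda>t. integral {0..t} (g \<psi>)) has_vector_derivative g \<psi> t) (at t within {0..t+1})"
        using t by (intro integral_has_vector_derivative gcont) auto
      then have "continuous (at t within {0..t+1}) (\<lambda>t. integral {0..t} (g \<psi>))"
        by (rule has_vector_derivative_continuous)
      moreover have "at t within {0..t+1} = at t within {0..}"
        by (rule at_within_nhd[of _ "{..<t+1}"]) auto
      ultimately show "continuous (at t within {0..}) (\<lambda>t. integral {0..t} (g \<psi>))" by simp
    qed
    moreover have "continuous_on UNIV (\<lambda>t::real. max 0 t)" "range (\<lambda>t::real. max 0 t) \<subseteq> {0..}"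
      by (auto intro!: continuous_intros)
    ultimately show ?thesis
      by (rule continuous_on_compose2)
  qed
  have Pb: "P \<psi> \<in> bcontfun" for \<psi>
  proof (rule bcontfun_normI)
    show "continuous_on UNIV (P \<psi>)"
      unfolding P_def by (intro continuous_intros Icont)
    fix t :: real
    define s where "s = max 0 t"
    have s: "s \<ge> 0" by (simp add: s_def)
    have "exp (- 2 * M * s) * norm (integral {0..s} (g \<psi>)) \<le> norm \<psi> / 2"
    proof (rule norm_integral_exp_weight_le[OF gcont s M])
      fix r
      have "norm (g \<psi> r) \<le> M * (exp (2 * M * r) * norm (apply_bcontfun \<psi> r))"
        using fnorm[of "exp (2 * M * r) *\<^sub>R apply_bcontfun \<psi> r"] by (simp add: g_def)
      also have "\<dots> \<le> M * (exp (2 * M * r) * norm \<psi>)"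
        using M by (intro mult_left_mono norm_bounded) auto
      finally show "norm (g \<psi> r) \<le> M * (exp (2 * M * r) * norm \<psi>)" .
    qed auto
    moreover have "exp (- 2 * M * s) * norm a \<le> norm a"
      using s M by (intro mult_left_le_one_le) auto
    moreover have "norm (P \<psi> t) \<le> exp (- 2 * M * s) * (norm a + norm (integral {0..s} (g \<psi>)))"
      unfolding P_def s_def[symmetric] by (simp add: norm_triangle_ineq)
    ultimately show "norm (P \<psi> t) \<le> norm a + norm \<psi> / 2"
      by (simp add: distrib_left)
  qed
  have contr: "dist (Bcontfun (P \<phi>)) (Bcontfun (P \<psi>)) \<le> 1/2 * dist \<phi> \<psi>" for \<phi> \<psi>
  proof (rule dist_bound)
    fix t :: real
    define s where "s = max 0 t"
    have s: "s \<ge> 0" by (simp add: s_def)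
    have "exp (- 2 * M * s) * norm (integral {0..s} (\<lambda>r. g \<phi> r - g \<psi> r)) \<le> dist \<phi> \<psi> / 2"
    proof (rule norm_integral_exp_weight_le[OF _ s M])
      show "continuous_on {0..s} (\<lambda>r. g \<phi> r - g \<psi> r)" by (intro continuous_intros gcont)
      fix r
      have "norm (g \<phi> r - g \<psi> r) \<le> M * (exp (2 * M * r) * dist (apply_bcontfun \<phi> r) (apply_bcontfun \<psi> r))"
        using fdist[of "exp (2 * M * r) *\<^sub>R apply_bcontfun \<phi> r" "exp (2 * M * r) *\<^sub>R apply_bcontfun \<psi> r"]
        by (simp add: g_def dist_norm flip: scaleR_diff_right)
      also have "\<dots> \<le> M * (exp (2 * M * r) * dist \<phi> \<psi>)"
        using M by (intro mult_left_mono dist_bounded) auto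
      finally show "norm (g \<phi> r - g \<psi> r) \<le> M * (exp (2 * M * r) * dist \<phi> \<psi>)" .
    qed auto
    moreover have "P \<phi> t - P \<psi> t = exp (- 2 * M * s) *\<^sub>R integral {0..s} (\<lambda>r. g \<phi> r - g \<psi> r)"
      unfolding P_def s_def[symmetric]
      by (simp add: Henstock_Kurzweil_Integration.integral_diff[OF gint gint] flip: scaleR_diff_right)
    ultimately show "dist (apply_bcontfun (Bcontfun (P \<phi>)) t) (apply_bcontfun (Bcontfun (P \<psi>)) t) \<le> 1/2 * dist \<phi> \<psi>"
      by (simp add: Bcontfun_inverse[OF Pb] dist_norm)
  qed
  obtain \<psi> where \<psi>: "Bcontfun (P \<psi>) = \<psi>"
    using banach_fix_type[of "1/2" "\<lambda>\<psi>. Bcontfun (P \<psi>)"] contr by auto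
  define x where "x t = exp (2 * M * t) *\<^sub>R apply_bcontfun \<psi> t" for t
  have x: "x t = a + integral {0..t} (\<lambda>s. f (x s))" if "t \<ge> 0" for t
  proof -
    have "apply_bcontfun \<psi> t = P \<psi> t"
      by (metis Bcontfun_inverse[OF Pb] \<psi>)
    then have "x t = (exp (2 * M * t) * exp (- 2 * M * t)) *\<^sub>R (a + integral {0..t} (g \<psi>))"
      using that by (simp add: x_def P_def)
    then show ?thesis by (simp add: g_def[abs_def] x_def flip: exp_add)
  qed
  show ?thesis
  proof
    show "x 0 = a" using x[of 0] by simp
    fix t :: real assume t: "t \<ge> 0"
    have "((\<lambda>t. integral {0..t} (\<lambda>s. f (x s))) has_vector_derivative f (x t)) (at t within {0..t+1})"
      using t gcont[of "{0..t+1}" \<psi>] by (intro integral_has_vector_derivative) (auto simp: g_def x_def)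
    moreover have "at t within {0..t+1} = at t within {0..}"
      by (rule at_within_nhd[of _ "{..<t+1}"]) auto
    ultimately have "((\<lambda>t. a + integral {0..t} (\<lambda>s. f (x s))) has_vector_derivative f (x t)) (at t within {0..})"
      by (auto intro!: derivative_eq_intros)
    then show "(x has_vector_derivative f (x t)) (at t within {0..})"
      by (rule has_vector_derivative_transform[rotated 2]) (use t x in auto)
  qed
qed

section \<open>Growth of trajectories and linearization\<close>

text \<open>A Gronwall estimate through the energy: by Cauchy-Schwarz the weighted square
  \<open>exp (- 2 * L * s) * (x s \<bullet> x s)\<close> has nonpositive derivative. For
  \<open>x 0 = 0\<close> it says that the trajectory stays at the equilibrium.\<close>

lemma ode_solution_growth:
  fixes x :: "real \<Rightarrow> 'a::real_inner"
  assumes x: "\<And>t. t \<ge> 0 \<Longrightarrow> (x has_vector_derivative f (x t)) (at t within {0..})"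
    and f: "\<And>y. norm (f y) \<le> L * norm y" and t: "t \<ge> 0"
  shows "norm (x t) \<le> exp (L * t) * norm (x 0)"
proof -
  let ?h = "\<lambda>s. exp (- 2 * L * s) * (x s \<bullet> x s)"
  have "(?h has_real_derivative 2 * exp (- 2 * L * s) * (x s \<bullet> f (x s) - L * (x s \<bullet> x s))) (at s within {0..t})"
    if "s \<in> {0..t}" for s
  proof -
    have "(x has_derivative (\<lambda>h. h *\<^sub>R f (x s))) (at s within {0..t})"
      using x[of s] that has_derivative_subset[of x _ s "{0..}" "{0..t}"]
      by (auto simp: has_vector_derivative_def)
    then show ?thesis
      unfolding has_field_derivative_def
      by (auto intro!: derivative_eq_intros simp: fun_eq_iff inner_commute algebra_simps)
  qed
  then obtain s where s: "s \<in> {0..t}"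
    and eq: "?h t - ?h 0 = 2 * exp (- 2 * L * s) * (x s \<bullet> f (x s) - L * (x s \<bullet> x s)) * (t - 0)"
    using mvt_very_simple[OF t, of ?h "\<lambda>s h. 2 * exp (- 2 * L * s) * (x s \<bullet> f (x s) - L * (x s \<bullet> x s)) * h"]
    by (auto simp: has_field_derivative_def)
  have "x s \<bullet> f (x s) \<le> norm (x s) * (L * norm (x s))"
    using norm_cauchy_schwarz[of "x s" "f (x s)"] mult_left_mono[OF f[of "x s"], of "norm (x s)"] by simp
  then have "x s \<bullet> f (x s) - L * (x s \<bullet> x s) \<le> 0"
    by (simp add: power2_eq_square algebra_simps flip: power2_norm_eq_inner)
  then have "?h t \<le> ?h 0"
    using eq t by (smt (verit) exp_ge_zero mult_nonneg_nonneg mult_nonneg_nonpos mult_nonneg_nonpos2)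
  then have "exp (2 * L * t) * ?h t \<le> exp (2 * L * t) * ?h 0" by (rule mult_left_mono) simp
  moreover have "exp (2 * L * t) * ?h t = (norm (x t))\<^sup>2"
    by (simp add: power2_norm_eq_inner flip: mult.assoc exp_add)
  moreover have "exp (2 * L * t) * ?h 0 = (exp (L * t) * norm (x 0))\<^sup>2"
    by (simp add: power_mult_distrib power2_norm_eq_inner mult.assoc flip: exp_double)
  ultimately have "(norm (x t))\<^sup>2 \<le> (exp (L * t) * norm (x 0))\<^sup>2"
    by (simp only:)
  then show ?thesis by (rule power2_le_imp_le) simp
qed

text \<open>The integrating factor \<open>exp (- \<sigma> * s)\<close> leaves
  \<open>exp (- \<sigma> * s) * r s\<close> as derivative, and the mean value theorem evaluates the
  increment at one intermediate time. The absolute value of \<open>\<sigma>\<close> in the bound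
  covers both signs.\<close>

lemma scalar_ode_perturbation:
  fixes y :: "real \<Rightarrow> real"
  assumes y: "\<And>s. s \<in> {0..t} \<Longrightarrow> (y has_real_derivative \<sigma> * y s + r s) (at s within {0..t})"
    and r: "\<And>s. s \<in> {0..t} \<Longrightarrow> \<bar>r s\<bar> \<le> \<epsilon>" and t: "t \<ge> 0"
  shows "\<bar>y t - exp (\<sigma> * t) * y 0\<bar> \<le> exp (2 * \<bar>\<sigma>\<bar> * t) * t * \<epsilon>"
proof -
  let ?h = "\<lambda>s. exp (- \<sigma> * s) * y s"
  have "(?h has_real_derivative exp (- \<sigma> * s) * r s) (at s within {0..t})" if "s \<in> {0..t}" for s
    using y[OF that] by (auto intro!: derivative_eq_intros simp: algebra_simps)
  then obtain s where s: "s \<in> {0..t}" and eq: "?h t - ?h 0 = exp (- \<sigma> * s) * r s * (t - 0)"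
    using mvt_very_simple[OF t, of ?h "\<lambda>s h. exp (- \<sigma> * s) * r s * h"]
    by (auto simp: has_field_derivative_def)
  have \<epsilon>: "\<epsilon> \<ge> 0" using r[OF s] by linarith
  have "- \<sigma> * s \<le> \<bar>\<sigma>\<bar> * t" using s by (intro mult_mono) auto
  moreover have "\<sigma> * t \<le> \<bar>\<sigma>\<bar> * t" using t by (intro mult_right_mono) auto
  ultimately have le: "\<sigma> * t + - \<sigma> * s \<le> 2 * \<bar>\<sigma>\<bar> * t" by linarith
  have "exp (\<sigma> * t) * (?h t - ?h 0) = y t - exp (\<sigma> * t) * y 0"
    by (simp add: right_diff_distrib flip: mult.assoc exp_add)
  then have "y t - exp (\<sigma> * t) * y 0 = exp (\<sigma> * t + - \<sigma> * s) * t * r s"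
    unfolding eq exp_add by (simp only: diff_zero ac_simps)
  then have "\<bar>y t - exp (\<sigma> * t) * y 0\<bar> = exp (\<sigma> * t + - \<sigma> * s) * t * \<bar>r s\<bar>"
    using t by (simp add: abs_mult)
  also have "\<dots> \<le> exp (2 * \<bar>\<sigma>\<bar> * t) * t * \<epsilon>"
    using le r[OF s] t \<epsilon> by (intro mult_mono) auto
  finally show ?thesis .
qed

text \<open>Testing with an eigenvector \<open>e\<close> of the adjoint of \<open>A\<close> reduces
  the linearized equation to a scalar one. The component along \<open>e\<close> obeys it up to the
  remainder \<open>f - A\<close> along the trajectory, and the growth estimate makes this remainder
  small compared with \<open>norm a\<close> uniformly on \<open>{0..t}\<close>.\<close>

lemma flow_has_derivative_at_equilibrium:
  fixes f :: "'a::euclidean_space \<Rightarrow> 'a"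
  assumes flow: "\<And>a t. t \<ge> 0 \<Longrightarrow> (\<phi> a has_vector_derivative f (\<phi> a t)) (at t within {0..})"
    and init: "\<And>a. \<phi> a 0 = a"
    and L: "\<And>y. norm (f y) \<le> L * norm y"
    and D: "(f has_derivative A) (at 0)"
    and e: "\<And>h. A h \<bullet> e = \<sigma> * (h \<bullet> e)"
    and t: "t \<ge> 0"
  shows "((\<lambda>a. \<phi> a t \<bullet> e) has_derivative (\<lambda>a. exp (\<sigma> * t) * (a \<bullet> e))) (at 0)"
  unfolding has_derivative_at_alt
proof (intro conjI allI impI)
  show "bounded_linear (\<lambda>a. exp (\<sigma> * t) * (a \<bullet> e))"
    by (intro bounded_linear_intros)
  have f0: "f 0 = 0" using L[of 0] by simp
  have growth: "norm (\<phi> a s) \<le> exp (\<bar>L\<bar> * t) * norm a" if "s \<in> {0..t}" for a s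
  proof -
    have "norm (\<phi> a s) \<le> exp (L * s) * norm a"
      using ode_solution_growth[OF flow L, of s a] that init[of a] by simp
    also have "\<dots> \<le> exp (\<bar>L\<bar> * t) * norm a"
    proof -
      have "L * s \<le> \<bar>L\<bar> * t" using that by (intro mult_mono) auto
      then show ?thesis by (intro mult_right_mono) auto
    qed
    finally show ?thesis .
  qed
  fix \<epsilon> :: real assume \<epsilon>: "\<epsilon> > 0"
  \<comment> \<open>\<open>C - 1\<close> is the factor that the final estimate puts in front of the
    remainder bound. Adding 1 keeps \<open>C\<close> positive even if \<open>t = 0\<close> or
    \<open>e = 0\<close>, so that \<open>\<epsilon> / C\<close> can serve as tolerance.\<close>
  define C where "C = exp (2 * \<bar>\<sigma>\<bar> * t) * t * norm e * exp (\<bar>L\<bar> * t) + 1"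
  have C: "C > 0" using t by (simp add: C_def add_nonneg_pos)
  obtain d where d: "d > 0" and rem: "\<And>y. norm y < d \<Longrightarrow> norm (f y - A y) \<le> \<epsilon> / C * norm y"
  proof -
    have "\<epsilon> / C > 0" using \<epsilon> C by simp
    then show ?thesis
      using D f0 that unfolding has_derivative_at_alt by (metis diff_zero)
  qed
  show "\<exists>d>0. \<forall>a. norm (a - 0) < d \<longrightarrow>
      norm (\<phi> a t \<bullet> e - \<phi> 0 t \<bullet> e - exp (\<sigma> * t) * ((a - 0) \<bullet> e)) \<le> \<epsilon> * norm (a - 0)"
  proof (intro exI conjI allI impI)
    \<comment> \<open>Trajectories starting this close to 0 remain in the ball of radius
      \<open>d\<close> up to time \<open>t\<close>.\<close>
    show "d / exp (\<bar>L\<bar> * t) > 0" using d by simp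
    fix a :: 'a assume a: "norm (a - 0) < d / exp (\<bar>L\<bar> * t)"
    let ?r = "\<lambda>s. (f (\<phi> a s) - A (\<phi> a s)) \<bullet> e"
    have "((\<lambda>s. \<phi> a s \<bullet> e) has_real_derivative \<sigma> * (\<phi> a s \<bullet> e) + ?r s) (at s within {0..t})"
      if s: "s \<in> {0..t}" for s
    proof -
      have "(\<phi> a has_vector_derivative f (\<phi> a s)) (at s within {0..t})"
        by (rule has_vector_derivative_within_subset[OF flow]) (use s in auto)
      then have "((\<lambda>s. \<phi> a s \<bullet> e) has_vector_derivative f (\<phi> a s) \<bullet> e) (at s within {0..t})"
        by (rule bounded_linear.has_vector_derivative[OF bounded_linear_inner_left])
      then show ?thesis
        by (simp add: has_real_derivative_iff_has_vector_derivative inner_diff_left e)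
    qed
    moreover have "\<bar>?r s\<bar> \<le> \<epsilon> / C * (exp (\<bar>L\<bar> * t) * norm a) * norm e" if s: "s \<in> {0..t}" for s
    proof -
      have "norm (\<phi> a s) < d"
        using growth[OF s, of a] a by (simp add: field_simps)
      then have "norm (f (\<phi> a s) - A (\<phi> a s)) \<le> \<epsilon> / C * (exp (\<bar>L\<bar> * t) * norm a)"
        using rem growth[OF s, of a] \<epsilon> C
        by (meson divide_nonneg_pos less_imp_le mult_left_mono order_trans)
      then show ?thesis
        by (meson Cauchy_Schwarz_ineq2 mult_right_mono norm_ge_zero order_trans)
    qed
    ultimately have "\<bar>\<phi> a t \<bullet> e - exp (\<sigma> * t) * (\<phi> a 0 \<bullet> e)\<bar>
        \<le> exp (2 * \<bar>\<sigma>\<bar> * t) * t * (\<epsilon> / C * (exp (\<bar>L\<bar> * t) * norm a) * norm e)"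
      using t by (rule scalar_ode_perturbation)
    also have "\<dots> = \<epsilon> * norm a * ((C - 1) / C)"
      by (simp add: C_def)
    also have "\<dots> \<le> \<epsilon> * norm a"
      using \<epsilon> C by (intro mult_left_le) (auto simp: field_simps)
    finally show "norm (\<phi> a t \<bullet> e - \<phi> 0 t \<bullet> e - exp (\<sigma> * t) * ((a - 0) \<bullet> e)) \<le> \<epsilon> * norm (a - 0)"
      using growth[of t 0] t by (simp add: init)
  qed
qed

section \<open>Orthonormal eigenbases of symmetric matrices\<close>

text \<open>A maximizer \<open>e\<close> of the quadratic form on the unit sphere of
  \<open>V\<close> is an eigenvector: the residual \<open>w = f e - q *\<^sub>R e\<close> lies in
  \<open>V\<close> and is orthogonal to \<open>e\<close>, and were it nonzero, a small move from
  \<open>e\<close> towards \<open>w\<close> would raise the Rayleigh quotient.\<close>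

lemma self_adjoint_eigenvector:
  fixes f :: "'a::euclidean_space \<Rightarrow> 'a"
  assumes lin: "linear f" and adj: "\<And>x y. f x \<bullet> y = x \<bullet> f y"
    and V: "subspace V" "V \<noteq> {0}" and inv: "\<And>x. x \<in> V \<Longrightarrow> f x \<in> V"
  obtains e \<mu> where "e \<in> V" "norm e = 1" "f e = \<mu> *\<^sub>R e"
proof -
  let ?q = "\<lambda>x. f x \<bullet> x"
  have "compact (sphere 0 1 \<inter> V)"
    using V by (intro compact_Int_closed closed_subspace) auto
  moreover have "sphere 0 1 \<inter> V \<noteq> {}"
  proof -
    obtain v where "v \<in> V" "v \<noteq> 0" using V subspace_0 by blast
    then have "v /\<^sub>R norm v \<in> sphere 0 1 \<inter> V" using V by (simp add: subspace_scale)
    then show ?thesis by blast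
  qed
  moreover have "continuous_on (sphere 0 1 \<inter> V) ?q"
    using linear_continuous_on[OF linear_conv_bounded_linear[THEN iffD1, OF lin]]
    by (intro continuous_on_inner continuous_on_id)
  ultimately have "\<exists>e\<in>sphere 0 1 \<inter> V. \<forall>x\<in>sphere 0 1 \<inter> V. ?q x \<le> ?q e"
    by (rule continuous_attains_sup)
  then obtain e where e: "e \<in> sphere 0 1 \<inter> V"
    and max: "\<And>x. x \<in> sphere 0 1 \<inter> V \<Longrightarrow> ?q x \<le> ?q e"
    by blast
  have le: "?q x \<le> ?q e * (x \<bullet> x)" if "x \<in> V" for x
  proof (cases "x = 0")
    case True
    then show ?thesis by (simp add: linear_0[OF lin])
  next
    case False
    then have "x /\<^sub>R norm x \<in> sphere 0 1 \<inter> V" using V that by (simp add: subspace_scale)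
    from max[OF this] have "?q x / (norm x * norm x) \<le> ?q e"
      by (simp add: linear_cmul[OF lin] divide_inverse ac_simps)
    moreover have "norm x * norm x = x \<bullet> x" by (simp add: dot_square_norm power2_eq_square)
    ultimately show ?thesis
      using False by (simp add: pos_divide_le_eq)
  qed
  define q where "q = ?q e"
  define w where "w = f e - q *\<^sub>R e"
  have ee: "e \<bullet> e = 1" using e by (simp add: norm_eq_1)
  have w: "w \<in> V" using e V inv by (simp add: w_def subspace_diff subspace_scale)
  have we: "w \<bullet> e = 0" by (simp add: w_def inner_diff_left ee q_def)
  have fe: "f e = w + q *\<^sub>R e" by (simp add: w_def)
  have few: "f e \<bullet> w = w \<bullet> w" by (simp add: fe inner_add_left we inner_commute[of e w])
  have fwe: "f w \<bullet> e = w \<bullet> w" using adj[of w e] few by (simp add: inner_commute)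
  have quad: "2 * t * (w \<bullet> w) \<le> t\<^sup>2 * (q * (w \<bullet> w) - ?q w)" for t
  proof -
    have "e + t *\<^sub>R w \<in> V" using e w V by (simp add: subspace_add subspace_scale)
    from le[OF this] have "?q e + t * (f e \<bullet> w) + t * (f w \<bullet> e) + t\<^sup>2 * ?q w
        \<le> ?q e * (e \<bullet> e + 2 * t * (w \<bullet> e) + t\<^sup>2 * (w \<bullet> w))"
      by (simp add: linear_add[OF lin] linear_cmul[OF lin] inner_add_left inner_add_right
          inner_commute[of e w] power2_eq_square algebra_simps)
    then show ?thesis
      by (simp add: ee we few fwe q_def[symmetric] algebra_simps)
  qed
  have "w \<bullet> w = 0"
  proof (rule ccontr)
    assume "w \<bullet> w \<noteq> 0"
    then have pos: "w \<bullet> w > 0" by simp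
    \<comment> \<open>\<open>c\<close> is positive and dominates the quadratic coefficient in
      \<open>quad\<close>; at \<open>t = (w \<bullet> w) / c\<close> the quadratic term is then at
      most half the linear one.\<close>
    define c where "c = \<bar>q * (w \<bullet> w) - ?q w\<bar> + 1"
    define t where "t = (w \<bullet> w) / c"
    have c: "c > 0" and t: "t > 0" using pos by (auto simp: c_def t_def)
    have "2 * t * (w \<bullet> w) \<le> t\<^sup>2 * c"
      using quad[of t] by (rule order_trans) (auto intro!: mult_left_mono simp: c_def)
    also have "\<dots> = t * (w \<bullet> w)" using c by (simp add: t_def power2_eq_square)
    finally show False using t pos by (simp add: not_le)
  qed
  then show ?thesis using e that[of e q] by (simp add: w_def)
qed

text \<open>Induction on the dimension: after splitting off one eigenvector, its orthogonal
  complement in \<open>V\<close> is again invariant by self-adjointness. Allowing any invariant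
  subspace is what makes the induction work.\<close>

lemma self_adjoint_orthonormal_eigenbasis:
  fixes f :: "'a::euclidean_space \<Rightarrow> 'a"
  assumes lin: "linear f" and adj: "\<And>x y. f x \<bullet> y = x \<bullet> f y"
    and "subspace V" and "\<And>x. x \<in> V \<Longrightarrow> f x \<in> V"
  shows "\<exists>B\<subseteq>V. pairwise orthogonal B \<and> (\<forall>b\<in>B. norm b = 1 \<and> (\<exists>\<mu>. f b = \<mu> *\<^sub>R b)) \<and> span B = V"
  using assms(3,4)
proof (induction "dim V" arbitrary: V rule: less_induct)
  case less
  show ?case
  proof (cases "V = {0}")
    case True
    then show ?thesis by (intro exI[of _ "{}"]) auto
  next
    case False
    obtain e \<mu> where e: "e \<in> V" "norm e = 1" "f e = \<mu> *\<^sub>R e"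
      using self_adjoint_eigenvector[OF lin adj less.prems(1) False less.prems(2)] by blast
    have ee: "e \<bullet> e = 1" using e by (simp add: norm_eq_1)
    define W where "W = V \<inter> {x. e \<bullet> x = 0}"
    have W: "subspace W" unfolding W_def by (intro subspace_inter less.prems subspace_hyperplane)
    have "e \<notin> W" using ee by (simp add: W_def)
    then have "W \<subset> V" using e(1) unfolding W_def by blast
    then have "dim W < dim V"
      using W less.prems(1) by (intro dim_psubset) (simp only: span_eq_iff[THEN iffD2])
    moreover have "f x \<in> W" if "x \<in> W" for x
      using that less.prems adj[of e x] e by (simp add: W_def)
    ultimately obtain B where B: "B \<subseteq> W" "pairwise orthogonal B"
        "\<forall>b\<in>B. norm b = 1 \<and> (\<exists>\<mu>. f b = \<mu> *\<^sub>R b)" "span B = W"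
      using less.hyps W by meson
    have "span (insert e B) = V"
    proof
      show "span (insert e B) \<subseteq> V"
        using B e less.prems(1) by (intro span_minimal) (auto simp: W_def)
      show "V \<subseteq> span (insert e B)"
      proof
        fix x assume x: "x \<in> V"
        have "x - (e \<bullet> x) *\<^sub>R e \<in> span B"
          using x e less.prems(1) by (simp add: B W_def subspace_diff subspace_scale inner_diff_right ee)
        then show "x \<in> span (insert e B)" by (auto simp: span_insert)
      qed
    qed
    moreover have "pairwise orthogonal (insert e B)"
      using B by (auto simp: pairwise_insert W_def orthogonal_def inner_commute)
    ultimately show ?thesis
      using B e by (intro exI[of _ "insert e B"]) (auto simp: W_def)
  qed
qed

lemma symmetric_matrix_orthonormal_eigenbasis:
  fixes F :: "real ^ 'n ^ 'n"
  assumes "transpose F = F"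
  obtains e :: "'n \<Rightarrow> real ^ 'n" and \<mu> :: "'n \<Rightarrow> real"
  where "\<And>i j. e i \<bullet> e j = (if i = j then 1 else 0)"
    and "\<And>i. F *v e i = \<mu> i *\<^sub>R e i"
proof -
  have adj: "(F *v x) \<bullet> y = x \<bullet> (F *v y)" for x y
    using assms dot_lmul_matrix[of x F y] transpose_matrix_vector[of F x] by simp
  obtain B where B: "pairwise orthogonal B" "\<forall>b\<in>B. norm b = 1 \<and> (\<exists>\<mu>. F *v b = \<mu> *\<^sub>R b)"
      "span B = (UNIV :: (real ^ 'n) set)"
    using self_adjoint_orthonormal_eigenbasis[OF matrix_vector_mul_linear adj, of UNIV] by auto
  have ind: "independent B"
    using B by (intro pairwise_orthogonal_independent) auto
  then have "card B = CARD('n)"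
    using dim_eq_card_independent[OF ind] dim_span[of B] B(3) by simp
  moreover have "finite B" using ind by (rule independent_imp_finite)
  ultimately obtain e where e: "bij_betw e (UNIV :: 'n set) B"
    using finite_same_card_bij[of "UNIV :: 'n set" B] by auto
  have eB: "e i \<in> B" for i using bij_betwE[OF e] by simp
  then have "\<forall>i. \<exists>\<mu>. F *v e i = \<mu> *\<^sub>R e i" using B(2) by simp
  then obtain \<mu> where "\<And>i. F *v e i = \<mu> i *\<^sub>R e i" by metis
  moreover have "e i \<bullet> e j = (if i = j then 1 else 0)" for i j
  proof (cases "i = j")
    case True
    then show ?thesis using B(2) eB[of j] by (simp add: dot_square_norm)
  next
    case False
    then have "e i \<noteq> e j" using bij_betw_imp_inj_on[OF e] by (simp add: inj_eq)
    then show ?thesis using False pairwiseD[OF B(1) eB eB] by (simp add: orthogonal_def)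
  qed
  ultimately show ?thesis using that by blast
qed

text \<open>Orthonormality says \<open>Q ** transpose Q = mat 1\<close> for the matrix with rows
  \<open>e i\<close>. A one-sided inverse of a square matrix is two-sided, and
  \<open>transpose Q ** Q = mat 1\<close> is the expansion.\<close>

lemma orthonormal_family_expansion:
  fixes e :: "'n::finite \<Rightarrow> real ^ 'n"
  assumes e: "\<And>i j. e i \<bullet> e j = (if i = j then 1 else 0)"
  shows "(\<Sum>i\<in>UNIV. (x \<bullet> e i) *\<^sub>R e i) = x"
proof -
  define Q :: "real ^ 'n ^ 'n" where "Q = (\<chi> i. e i)"
  have "Q ** transpose Q = mat 1"
    using e by (simp add: matrix_matrix_mult_def transpose_def mat_def Q_def vec_eq_iff inner_vec_def)
  then have "transpose Q ** Q = mat 1" by (simp add: matrix_left_right_inverse)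
  then have "transpose Q *v (Q *v x) = x" by (simp add: matrix_vector_mul_assoc)
  moreover have "transpose Q *v (Q *v x) = (\<Sum>i\<in>UNIV. (x \<bullet> e i) *\<^sub>R e i)"
    by (simp add: matrix_vector_mult_def transpose_def Q_def vec_eq_iff inner_vec_def mult.commute)
  ultimately show ?thesis by simp
qed

text \<open>Multiplying \<open>F\<close> by the matrix with columns \<open>e i\<close> scales the
  columns by the eigenvalues; take determinants and cancel the nonzero \<open>det Q\<close>.\<close>

lemma det_eq_prod_eigenvalues:
  fixes F :: "real ^ 'n ^ 'n" and e :: "'n \<Rightarrow> real ^ 'n"
  assumes e: "\<And>i j. e i \<bullet> e j = (if i = j then 1 else 0)"
    and \<mu>: "\<And>i. F *v e i = \<mu> i *\<^sub>R e i"
  shows "det F = (\<Prod>i\<in>UNIV. \<mu> i)"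
proof -
  define Q :: "real ^ 'n ^ 'n" where "Q = (\<chi> i. e i)"
  have "Q ** transpose Q = mat 1"
    using e by (simp add: matrix_matrix_mult_def transpose_def mat_def Q_def vec_eq_iff inner_vec_def)
  then have Q: "det Q \<noteq> 0"
    by (metis det_I det_mul mult_zero_left zero_neq_one)
  have "F ** transpose Q = transpose (\<chi> i. \<mu> i *s e i)"
    using \<mu> by (simp add: vec_eq_iff matrix_matrix_mult_def transpose_def Q_def matrix_vector_mult_def)
  then have "det F * det Q = det (\<chi> i. \<mu> i *s e i)"
    by (metis det_mul det_transpose)
  also have "\<dots> = (\<Prod>i\<in>UNIV. \<mu> i) * det Q"
    unfolding Q_def by (rule det_rows_mul)
  finally show ?thesis using Q by simp
qed

section \<open>Beltrami waves\<close>

lemma advection_eq_derivative: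
  assumes "(w has_derivative D) (at x)"
  shows "advection v w x = D (v x)"
proof -
  have lin: "linear D" using assms by (rule has_derivative_linear)
  have "advection v w x = (\<Sum>j\<in>UNIV. (v x $ j) *\<^sub>R D (axis j 1))"
    using frechet_derivative_at[OF assms] by (simp add: advection_def partial_deriv_def)
  also have "\<dots> = D (\<Sum>j\<in>UNIV. v x $ j *s axis j 1)"
    by (simp add: linear_sum[OF lin] linear_cmul[OF lin] scalar_mult_eq_scaleR)
  finally show ?thesis by (simp add: basis_expansion)
qed

lemma gradient_eq_of_derivative:
  assumes "(f has_derivative (\<lambda>h. g \<bullet> h)) (at x)"
  shows "gradient f x = g"
  using frechet_derivative_at[OF assms, symmetric]
  by (simp add: gradient_def partial_deriv_def inner_axis vec_eq_iff)

text \<open>The antisymmetric part of a gradient is the cross product with the curl, here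
  \<open>l\<close> times the field itself, and the cross product of the field with itself vanishes.
  Hence the gradient and its transpose agree on the field, which makes the advection term a
  gradient.\<close>

lemma wave_deriv_selfadjoint_on_beltrami:
  fixes K :: "(real ^ 3) set"
  assumes l: "l \<noteq> 0" and K: "\<And>k. k \<in> K \<Longrightarrow> k \<bullet> k = l\<^sup>2" and a: "\<And>k. k \<in> K \<Longrightarrow> k \<bullet> a k = 0"
  defines "b \<equiv> \<lambda>k. cross3 k (a k) /\<^sub>R l"
  shows "wave K a b x \<bullet> wave_deriv K a b x h = wave_deriv K a b x (wave K a b x) \<bullet> h"
proof -
  have lagrange: "cross3 (cross3 k u) w = (k \<bullet> w) *\<^sub>R u - (u \<bullet> w) *\<^sub>R k" for k u w :: "real ^ 3"
    by (simp add: cross3_simps forall_3)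
  have "(k \<bullet> w) * ((c *\<^sub>R a k - s *\<^sub>R b k) \<bullet> z) - (k \<bullet> z) * ((c *\<^sub>R a k - s *\<^sub>R b k) \<bullet> w)
      = l * (cross3 (s *\<^sub>R a k + c *\<^sub>R b k) w \<bullet> z)" if k: "k \<in> K" for k w z c s
  proof -
    have "cross3 k (cross3 k (a k)) = (k \<bullet> a k) *\<^sub>R k - (k \<bullet> k) *\<^sub>R a k"
      by (subst cross_skew, subst lagrange) (simp add: inner_commute)
    then have "cross3 k (b k) = - (l *\<^sub>R a k)"
      using l by (simp add: b_def cross_mult_right a[OF k] K[OF k] power2_eq_square)
    moreover have "cross3 k (a k) = l *\<^sub>R b k" using l by (simp add: b_def)
    \<comment> \<open>This is the equation \<open>curl v = l v\<close> for a single wave.\<close>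
    ultimately have curl: "cross3 k (c *\<^sub>R a k - s *\<^sub>R b k) = l *\<^sub>R (s *\<^sub>R a k + c *\<^sub>R b k)"
      by (simp add: left_diff_distrib cross_mult_right algebra_simps Cross3.right_diff_distrib)
    have "l *\<^sub>R cross3 (s *\<^sub>R a k + c *\<^sub>R b k) w =
        (k \<bullet> w) *\<^sub>R (c *\<^sub>R a k - s *\<^sub>R b k) - ((c *\<^sub>R a k - s *\<^sub>R b k) \<bullet> w) *\<^sub>R k"
      by (simp only: lagrange[symmetric] curl cross_mult_left)
    from arg_cong[OF this, of "\<lambda>u. u \<bullet> z"] show ?thesis
      by (simp add: inner_diff_left mult.commute)
  qed
  then have "wave_deriv K a b x w \<bullet> z - wave_deriv K a b x z \<bullet> w = (\<Sum>k\<in>K. l *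
      (cross3 (sin (k \<bullet> x) *\<^sub>R a k + cos (k \<bullet> x) *\<^sub>R b k) w \<bullet> z))" for w z
    unfolding wave_deriv_def inner_sum_left sum_subtractf[symmetric] inner_scaleR_left
    by (intro sum.cong refl) blast
  also have "(\<Sum>k\<in>K. l * (cross3 (sin (k \<bullet> x) *\<^sub>R a k + cos (k \<bullet> x) *\<^sub>R b k) w \<bullet> z)) =
      l * (cross3 (wave K a b x) w \<bullet> z)" for w z
  proof -
    have "linear (\<lambda>u. l * (cross3 u w \<bullet> z))"
      by (rule linearI) (simp_all add: cross_add_left cross_mult_left inner_add_left distrib_left)
    from linear_sum[OF this, symmetric] show ?thesis unfolding wave_def .
  qed
  finally have "wave_deriv K a b x (wave K a b x) \<bullet> h - wave_deriv K a b x h \<bullet> wave K a b x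
      = l * (cross3 (wave K a b x) (wave K a b x) \<bullet> h)" .
  then show ?thesis by (simp add: inner_commute)
qed

lemma analytic_periodic_solution_beltrami_wave:
  fixes K :: "(real ^ 3) set"
  assumes l: "l \<noteq> 0" and K: "\<And>k. k \<in> K \<Longrightarrow> k \<bullet> k = l\<^sup>2" and a: "\<And>k. k \<in> K \<Longrightarrow> k \<bullet> a k = 0"
    and int: "\<And>k i. k \<in> K \<Longrightarrow> k $ i \<in> \<int>"
  defines "v \<equiv> wave K a (\<lambda>k. cross3 k (a k) /\<^sub>R l)"
  shows "analytic_periodic_solution \<nu> (\<lambda>x t. exp (- \<nu> * l\<^sup>2 * t) *\<^sub>R v x)
    (\<lambda>x t. - (exp (- \<nu> * l\<^sup>2 * t))\<^sup>2 * (v x \<bullet> v x) / 2)"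
  unfolding analytic_periodic_solution_def
proof (intro conjI allI impI)
  let ?b = "\<lambda>k. cross3 k (a k) /\<^sub>R l"
  show "real_analytic_on (\<lambda>(x, t). exp (- \<nu> * l\<^sup>2 * t) *\<^sub>R v x) (UNIV \<times> {0..})"
    unfolding v_def by (rule real_analytic_on_wave)
  have eq: "- (exp (- \<nu> * l\<^sup>2 * t))\<^sup>2 * (v x \<bullet> v x) / 2
      = (exp ((- 2 * \<nu> * l\<^sup>2) * t) * (v x \<bullet> v x)) *\<^sub>R (- (1/2))" for x t
    by (simp flip: exp_double)
  show "real_analytic_on (\<lambda>(x, t). - (exp (- \<nu> * l\<^sup>2 * t))\<^sup>2 * (v x \<bullet> v x) / 2) (UNIV \<times> {0..})"
    unfolding eq unfolding v_def by (rule real_analytic_on_wave_inner_wave)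
  fix t :: real
  have "torus_periodic v" unfolding v_def using int by (rule torus_periodic_wave)
  then show "torus_periodic (\<lambda>x. exp (- \<nu> * l\<^sup>2 * t) *\<^sub>R v x)"
    "torus_periodic (\<lambda>x. - (exp (- \<nu> * l\<^sup>2 * t))\<^sup>2 * (v x \<bullet> v x) / 2)"
    by (simp_all add: torus_periodic_def)
  fix x :: "real ^ 3"
  define c where "c = exp (- \<nu> * l\<^sup>2 * t)"
  define D where "D = wave_deriv K a ?b x"
  \<comment> \<open>Moving the time factor into the amplitudes makes the wave lemmas apply to the
    field at time \<open>t\<close>.\<close>
  have scaled: "(\<lambda>y. c *\<^sub>R v y) = wave K (\<lambda>k. c *\<^sub>R a k) (\<lambda>k. c *\<^sub>R ?b k)"
    by (rule ext) (simp only: v_def wave_scaleR)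
  have dv: "(v has_derivative D) (at x)"
    unfolding v_def D_def by (rule wave_has_derivative)
  have lin: "linear D" using dv by (rule has_derivative_linear)
  have sym: "v x \<bullet> D h = D (v x) \<bullet> h" for h
    unfolding v_def D_def by (rule wave_deriv_selfadjoint_on_beltrami[OF l K a])
  have "divergence (\<lambda>y. c *\<^sub>R v y) x = 0"
    unfolding scaled by (rule divergence_wave) (simp_all add: a dot_cross_self)
  then show "divergence (\<lambda>y. exp (- \<nu> * l\<^sup>2 * t) *\<^sub>R v y) x = 0" by (simp only: c_def)
  have lap: "laplacian (\<lambda>y. c *\<^sub>R v y) x = - l\<^sup>2 *\<^sub>R (c *\<^sub>R v x)"
    using laplacian_wave[OF K, of K "\<lambda>k. c *\<^sub>R a k" "\<lambda>k. c *\<^sub>R ?b k" x]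
    by (simp only: scaled[symmetric])
  have "((\<lambda>y. c *\<^sub>R v y) has_derivative (\<lambda>h. c *\<^sub>R D h)) (at x)"
    using dv by (rule has_derivative_scaleR_right)
  from advection_eq_derivative[OF this, of "\<lambda>y. c *\<^sub>R v y"]
  have adv: "advection (\<lambda>y. c *\<^sub>R v y) (\<lambda>y. c *\<^sub>R v y) x = c\<^sup>2 *\<^sub>R D (v x)"
    by (simp add: linear_cmul[OF lin] power2_eq_square)
  \<comment> \<open>The derivative of \<open>v y \<bullet> v y\<close> at \<open>x\<close> is
    \<open>2 * (v x \<bullet> D h)\<close>, which \<open>sym\<close> turns into
    \<open>2 * (D (v x) \<bullet> h)\<close>.\<close>
  have "((\<lambda>y. - c\<^sup>2 * (v y \<bullet> v y) / 2) has_derivative (\<lambda>h. (- c\<^sup>2 *\<^sub>R D (v x)) \<bullet> h)) (at x)"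
    using dv by (auto intro!: derivative_eq_intros simp: fun_eq_iff sym inner_commute[of "D _" "v x"])
  then have grad: "gradient (\<lambda>y. - c\<^sup>2 * (v y \<bullet> v y) / 2) x = - c\<^sup>2 *\<^sub>R D (v x)"
    by (rule gradient_eq_of_derivative)
  have "((\<lambda>s. exp (- \<nu> * l\<^sup>2 * s) *\<^sub>R v x) has_vector_derivative (- \<nu> * l\<^sup>2 * c) *\<^sub>R v x) (at t)"
    unfolding c_def by (auto intro!: derivative_eq_intros simp: has_vector_derivative_def fun_eq_iff)
  then have "vector_derivative (\<lambda>s. exp (- \<nu> * l\<^sup>2 * s) *\<^sub>R v x) (at t) = (- \<nu> * l\<^sup>2 * c) *\<^sub>R v x"
    by (rule vector_derivative_at)
  \<comment> \<open>Advection and pressure gradient cancel, leaving the heat equation for an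
    eigenfunction of the Laplacian.\<close>
  then show "vector_derivative (\<lambda>s. exp (- \<nu> * l\<^sup>2 * s) *\<^sub>R v x) (at t) +
      advection (\<lambda>y. exp (- \<nu> * l\<^sup>2 * t) *\<^sub>R v y) (\<lambda>y. exp (- \<nu> * l\<^sup>2 * t) *\<^sub>R v y) x +
      gradient (\<lambda>y. - (exp (- \<nu> * l\<^sup>2 * t))\<^sup>2 * (v y \<bullet> v y) / 2) x =
      \<nu> *\<^sub>R laplacian (\<lambda>y. exp (- \<nu> * l\<^sup>2 * t) *\<^sub>R v y) x"
    unfolding c_def[symmetric] adv grad lap by (simp add: mult.assoc)
qed

section \<open>Amplitudes with a prescribed gradient at the origin\<close>

text \<open>The wave vectors are alternate vertices of a cube, that is, the vertices of a regular
  tetrahedron. Each \<open>a k\<close> is \<open>M *v k / 4\<close> minus its projection onto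
  \<open>k\<close>; as \<open>k \<bullet> k = 3\<close>, the projection has denominator 12.\<close>

lemma trace_free_symmetric_decomposition:
  fixes S :: "real ^ 3 ^ 3"
  assumes "transpose S = S" "trace S = 0"
  obtains K :: "(real ^ 3) set" and a where
    "\<And>k. k \<in> K \<Longrightarrow> k \<bullet> k = 3" "\<And>k i. k \<in> K \<Longrightarrow> k $ i \<in> \<int>" "\<And>k. k \<in> K \<Longrightarrow> k \<bullet> a k = 0"
    "\<And>h. (\<Sum>k\<in>K. (k \<bullet> h) *\<^sub>R a k) = S *v h"
proof
  have S: "S $ 2 $ 1 = S $ 1 $ 2" "S $ 3 $ 1 = S $ 1 $ 3" "S $ 3 $ 2 = S $ 2 $ 3"
    using assms(1) by (auto simp: transpose_def vec_eq_iff)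
  have tr: "S $ 3 $ 3 = - S $ 1 $ 1 - S $ 2 $ 2" using assms(2) by (simp add: trace_def sum_3)
  let ?K = "{vector [1, 1, 1], vector [1, -1, -1], vector [-1, 1, -1], vector [-1, -1, 1]} :: (real ^ 3) set"
  text \<open>
    The matrices \<open>k k\<^sup>T\<close> add up to \<open>4 I\<close>, but removing from \<open>S k / 4\<close> its component along \<open>k\<close> shrinks the
    off-diagonal part of the sum to a third; \<open>M\<close> compensates for this.
  \<close>
  define M :: "real ^ 3 ^ 3" where "M = (\<chi> i j. if i = j then S $ i $ j else 3 * S $ i $ j)"
  define a where "a k = (M *v k) /\<^sub>R 4 - ((k \<bullet> (M *v k)) / 12) *\<^sub>R k" for k
  show K: "k \<bullet> k = 3" if "k \<in> ?K" for k
    using that by (auto simp: inner_vec_def sum_3)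
  show "k $ i \<in> \<int>" if "k \<in> ?K" for k i
    using that exhaust_3[of i] by auto
  show "k \<bullet> a k = 0" if "k \<in> ?K" for k
    using K[OF that] by (simp add: a_def inner_diff_right)
  have sum4: "(\<Sum>k\<in>?K. g k) = g (vector [1, 1, 1]) + g (vector [1, -1, -1]) + g (vector [-1, 1, -1])
      + g (vector [-1, -1, 1])" for g :: "real ^ 3 \<Rightarrow> real ^ 3"
    by (simp add: vec_eq_iff forall_3 add.assoc)
  show "(\<Sum>k\<in>?K. (k \<bullet> h) *\<^sub>R a k) = S *v h" for h
    unfolding sum4
    by (simp add: a_def M_def vec_eq_iff forall_3 matrix_vector_mult_def inner_vec_def sum_3 S tr field_simps)
qed

lemma wave_at_0: "wave K a b 0 = (\<Sum>k\<in>K. b k)"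
  by (simp add: wave_def)

lemma wave_deriv_at_0: "wave_deriv K a b 0 h = (\<Sum>k\<in>K. (k \<bullet> h) *\<^sub>R a k)"
  by (simp add: wave_deriv_def)

text \<open>The components of the sum are differences of opposite off-diagonal entries of
  \<open>S\<close>. Up to the factor \<open>1 / l\<close> the sum is the value of the Beltrami wave
  at the origin, so 0 becomes an equilibrium.\<close>

lemma sum_cross_eq_0_of_symmetric:
  fixes K :: "(real ^ 3) set"
  assumes "\<And>h. (\<Sum>k\<in>K. (k \<bullet> h) *\<^sub>R a k) = S *v h" and "transpose S = S"
  shows "(\<Sum>k\<in>K. cross3 k (a k)) = 0"
proof -
  have "(\<Sum>k\<in>K. k $ j * a k $ i) = S $ i $ j" for i j
    using arg_cong[OF assms(1)[of "axis j 1"], of "\<lambda>v. v $ i"]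
    by (simp add: inner_axis matrix_vector_mul_component)
  moreover have "S $ i $ j = S $ j $ i" for i j
    using arg_cong[OF assms(2), of "\<lambda>A. A $ i $ j"] by (simp add: transpose_def)
  ultimately have "(\<Sum>k\<in>K. k $ j * a k $ i) = (\<Sum>k\<in>K. a k $ j * k $ i)" for i j
    by (simp add: mult.commute)
  then show ?thesis
    by (simp add: vec_eq_iff forall_3 cross_components sum_subtractf)
qed

section \<open>Change of time and construction of the solution\<close>

text \<open>\<open>\<theta>\<close> is the integral of the decay factor. Its closed form
  \<open>(1 - exp (- \<beta> * t)) / \<beta>\<close> would be constantly 0 for
  \<open>\<beta> = 0\<close>, since division by zero yields 0; in that case \<open>\<theta>\<close>
  is the identity.\<close>

lemma decay_time_change:
  fixes \<beta> :: real
  assumes "\<beta> \<ge> 0"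
  obtains \<theta> where "\<theta> 0 = 0" "\<And>t. (\<theta> has_real_derivative exp (- \<beta> * t)) (at t)"
    "\<And>t. t > 0 \<Longrightarrow> \<theta> t > 0"
proof (cases "\<beta> = 0")
  case True
  then show ?thesis by (intro that[of "\<lambda>t. t"]) auto
next
  case False
  with assms have "\<beta> > 0" by simp
  then show ?thesis
    by (intro that[of "\<lambda>t. (1 - exp (- \<beta> * t)) / \<beta>"]) (auto intro!: derivative_eq_intros)
qed

text \<open>A scalar factor depending only on time changes the speed along the orbits of
  \<open>v\<close> but not the orbits; this is the chain rule.\<close>

lemma lagrangian_flow_time_change:
  fixes v :: "real ^ 'n \<Rightarrow> real ^ 'n"
  assumes \<phi>: "\<And>a t. t \<ge> 0 \<Longrightarrow> (\<phi> a has_vector_derivative v (\<phi> a t)) (at t within {0..})" "\<And>a. \<phi> a 0 = a"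
    and \<theta>: "\<theta> 0 = 0" "\<And>t. (\<theta> has_real_derivative g t) (at t)" "\<And>t. t \<ge> 0 \<Longrightarrow> \<theta> t \<ge> 0"
  shows "lagrangian_flow (\<lambda>x t. g t *\<^sub>R v x) (\<lambda>a t. \<phi> a (\<theta> t))"
  unfolding lagrangian_flow_def
proof (intro allI impI conjI)
  show "\<phi> a (\<theta> 0) = a" for a by (simp add: \<theta> \<phi>)
  fix a t assume t: "(t::real) \<ge> 0"
  have "(\<theta> has_vector_derivative g t) (at t within {0..})"
    using \<theta>(2)[of t]
    by (simp add: has_real_derivative_iff_has_vector_derivative has_vector_derivative_at_within)
  moreover have "(\<phi> a has_vector_derivative v (\<phi> a (\<theta> t))) (at (\<theta> t) within \<theta> ` {0..})"
    by (rule has_vector_derivative_within_subset[OF \<phi>(1)]) (use \<theta> t in auto)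
  ultimately show "((\<lambda>s. \<phi> a (\<theta> s)) has_vector_derivative g t *\<^sub>R v (\<phi> a (\<theta> t))) (at t within {0..})"
    by (rule vector_diff_chain_within[unfolded o_def])
qed

theorem theorem2p4:
  fixes F :: "real ^ 3 ^ 3" and T \<nu> :: real
  assumes "transpose F = F"
    and "\<And>x. x \<noteq> 0 \<Longrightarrow> x \<bullet> (F *v x) > 0"
    and "det F = 1"
    and "T > 0"
    and "\<nu> \<ge> 0"
  shows "\<exists>u p X. analytic_periodic_solution \<nu> u p \<and> lagrangian_flow u X \<and>
           (\<forall>t\<in>{0..T}. X 0 t = 0) \<and>
           (\<lambda>a. X a T) differentiable (at 0) \<and>
           jacobian (\<lambda>a. X a T) (at 0) = F"
proof -
  obtain e :: "3 \<Rightarrow> real ^ 3" and \<mu> where e: "\<And>i j. e i \<bullet> e j = (if i = j then 1 else 0)"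
    and \<mu>: "\<And>i. F *v e i = \<mu> i *\<^sub>R e i"
    using symmetric_matrix_orthonormal_eigenbasis[OF assms(1)] by blast
  have pos: "\<mu> i > 0" for i
  proof -
    have "e i \<noteq> 0" using e[of i i] by auto
    from assms(2)[OF this] show ?thesis by (simp add: \<mu> e)
  qed
  obtain \<theta> where \<theta>: "\<theta> 0 = 0" "\<And>t. (\<theta> has_real_derivative exp (- (\<nu> * 3) * t)) (at t)"
    "\<And>t. t > 0 \<Longrightarrow> \<theta> t > 0"
    using decay_time_change[of "\<nu> * 3"] assms(5) by auto
  have \<theta>nonneg: "\<theta> t \<ge> 0" if "t \<ge> 0" for t
    using \<theta>(1) \<theta>(3)[of t] that by (cases "t = 0") auto
  \<comment> \<open>These are the eigenvalues of \<open>log F / \<theta> T\<close>, chosen so that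
    the linearized flow over the time \<open>\<theta> T\<close> multiplies \<open>e i\<close> by
    \<open>\<mu> i\<close>.\<close>
  define \<sigma> where "\<sigma> i = ln (\<mu> i) / \<theta> T" for i
  have exp_\<sigma>: "exp (\<sigma> i * \<theta> T) = \<mu> i" for i
    using \<theta>(3)[OF assms(4)] pos[of i] by (simp add: \<sigma>_def)
  define S :: "real ^ 3 ^ 3" where "S = (\<chi> p q. \<Sum>i\<in>UNIV. \<sigma> i * (e i $ p * e i $ q))"
  have S_mult: "S *v h = (\<Sum>i\<in>UNIV. (\<sigma> i * (h \<bullet> e i)) *\<^sub>R e i)" for h
    by (simp add: S_def vec_eq_iff matrix_vector_mult_def inner_vec_def sum_3 algebra_simps)
  have S_e: "(S *v h) \<bullet> e j = \<sigma> j * (h \<bullet> e j)" for h j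
    by (simp add: S_mult inner_sum_left e if_distrib cong: if_cong)
  have "transpose S = S"
    by (simp add: S_def transpose_def mult.commute)
  moreover have "trace S = 0"
  proof -
    \<comment> \<open>The trace is the logarithm of the product of the \<open>\<mu> i\<close>
      divided by \<open>\<theta> T\<close>, so \<open>det F = 1\<close> is exactly the trace
      condition.\<close>
    have "trace S = (\<Sum>i\<in>UNIV. \<sigma> i * (e i \<bullet> e i))"
      unfolding trace_def S_def inner_vec_def
      by (simp add: sum_distrib_left) (rule sum.swap)
    also have "\<dots> = ln (\<Prod>i\<in>UNIV. \<mu> i) / \<theta> T"
      using pos by (simp add: e \<sigma>_def ln_prod sum_divide_distrib less_imp_neq[THEN not_sym])
    also have "\<dots> = 0"
      using det_eq_prod_eigenvalues[OF e \<mu>] assms(3) by simp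
    finally show ?thesis .
  qed
  ultimately obtain K :: "(real ^ 3) set" and a where
    K: "\<And>k. k \<in> K \<Longrightarrow> k \<bullet> k = 3" "\<And>k i. k \<in> K \<Longrightarrow> k $ i \<in> \<int>" "\<And>k. k \<in> K \<Longrightarrow> k \<bullet> a k = 0"
    and Ka: "\<And>h. (\<Sum>k\<in>K. (k \<bullet> h) *\<^sub>R a k) = S *v h"
    using trace_free_symmetric_decomposition by blast
  define v where "v = wave K a (\<lambda>k. cross3 k (a k) /\<^sub>R sqrt 3)"
  have sol: "analytic_periodic_solution \<nu> (\<lambda>x t. exp (- (\<nu> * 3) * t) *\<^sub>R v x)
      (\<lambda>x t. - (exp (- (\<nu> * 3) * t))\<^sup>2 * (v x \<bullet> v x) / 2)"
    using analytic_periodic_solution_beltrami_wave[of "sqrt 3" K a \<nu>] K by (simp add: v_def)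
  have v0: "v 0 = 0"
    using sum_cross_eq_0_of_symmetric[OF Ka \<open>transpose S = S\<close>]
    by (simp add: v_def wave_at_0 flip: scaleR_sum_right)
  have v': "(v has_derivative (*v) S) (at 0)"
    unfolding v_def using wave_has_derivative[of K a _ 0]
    by (simp add: wave_deriv_at_0[abs_def] Ka)
  obtain L where L: "L-lipschitz_on UNIV v"
    unfolding v_def by (rule wave_lipschitz)
  have growth: "norm (v y) \<le> L * norm y" for y
    using lipschitz_onD[OF L, of y 0] by (simp add: v0)
  have "\<exists>x. x 0 = a \<and> (\<forall>t\<ge>0. (x has_vector_derivative v (x t)) (at t within {0..}))" for a
    using lipschitz_ode_global_solution[OF L v0, of a] by blast
  then have "\<exists>\<phi>. \<forall>a. \<phi> a 0 = a \<and> (\<forall>t\<ge>0. (\<phi> a has_vector_derivative v (\<phi> a t)) (at t within {0..}))"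
    by (intro choice allI)
  then obtain \<phi> where \<phi>: "\<And>a. \<phi> a 0 = a"
    "\<And>a t. t \<ge> 0 \<Longrightarrow> (\<phi> a has_vector_derivative v (\<phi> a t)) (at t within {0..})"
    by blast
  have flow: "lagrangian_flow (\<lambda>x t. exp (- (\<nu> * 3) * t) *\<^sub>R v x) (\<lambda>a t. \<phi> a (\<theta> t))"
    by (rule lagrangian_flow_time_change[OF \<phi>(2) \<phi>(1) \<theta>(1,2) \<theta>nonneg])
  \<comment> \<open>From the initial value 0 the growth estimate leaves only the zero
    trajectory.\<close>
  have fixed: "\<phi> 0 (\<theta> t) = 0" if "t \<in> {0..T}" for t
    using ode_solution_growth[OF \<phi>(2) growth \<theta>nonneg, of t 0] that by (simp add: \<phi>)
  \<comment> \<open>The linearization is diagonal in the basis \<open>e\<close>, so scalar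
    exponentials replace the matrix exponential; the components are then reassembled by the
    orthonormal expansion.\<close>
  have "((\<lambda>a. \<phi> a (\<theta> T) \<bullet> e i) has_derivative (\<lambda>a. \<mu> i * (a \<bullet> e i))) (at 0)" for i
    using flow_has_derivative_at_equilibrium[OF \<phi>(2,1) growth v' S_e \<theta>nonneg[OF less_imp_le[OF assms(4)]], of i]
    by (simp only: exp_\<sigma>)
  then have "((\<lambda>a. \<Sum>i\<in>UNIV. (\<phi> a (\<theta> T) \<bullet> e i) *\<^sub>R e i) has_derivative
      (\<lambda>a. \<Sum>i\<in>UNIV. (\<mu> i * (a \<bullet> e i)) *\<^sub>R e i)) (at 0)"
    by (intro has_derivative_sum has_derivative_scaleR_left)
  moreover have "(\<Sum>i\<in>UNIV. (\<mu> i * (a \<bullet> e i)) *\<^sub>R e i) = F *v a" for a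
  proof -
    have "F *v a = F *v (\<Sum>i\<in>UNIV. (a \<bullet> e i) *\<^sub>R e i)"
      by (simp add: orthonormal_family_expansion[OF e])
    also have "\<dots> = (\<Sum>i\<in>UNIV. (\<mu> i * (a \<bullet> e i)) *\<^sub>R e i)"
      by (simp add: linear_sum[OF matrix_vector_mul_linear] matrix_vector_mult_scaleR \<mu> mult.commute)
    finally show ?thesis ..
  qed
  ultimately have D: "((\<lambda>a. \<phi> a (\<theta> T)) has_derivative (*v) F) (at 0)"
    by (simp add: orthonormal_family_expansion[OF e])
  then have "jacobian (\<lambda>a. \<phi> a (\<theta> T)) (at 0) = F"
    by (simp add: jacobian_def frechet_derivative_at[OF D, symmetric])
  moreover have "(\<lambda>a. \<phi> a (\<theta> T)) differentiable (at 0)"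
    using D by (rule differentiableI)
  ultimately show ?thesis using sol flow fixed by blast
qed

end
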